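(* Let $K$ be a field and let $I,J\subset K[x_1,\ldots,x_n]$ be nonzero equigenerated graded ideals. Then $$\mu(IJ)\geq \mu(I)+\mu(J)-1.$$ In particular, $\mu(IJ)>\max\{\mu(I),\mu(J)\}$ if $I$ and $J$ are not principal.
   Context: $K[x_1,\ldots,x_n]$ is the standard graded polynomial ring over a field $K$. For a graded ideal $L$, $\mu(L)$ denotes the minimal number of generators of $L$. A graded ideal is equigenerated if it is generated by homogeneous elements all of the same degree ($I$ and $J$ may be generated in different degrees). *)

theory Defs
  imports Complex_Main "HOL-Library.Poly_Mapping"
begin

text \<open>
  \<open>K[x_1, \<dots>, x_n]\<close> is the ring of finitely supported functions from exponent vectors to \<open>K\<close>, with
  the convolution product of \<^theory>\<open>HOL-Library.Poly_Mapping\<close>. The variables are indexed by an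
  arbitrary finite type \<open>'x\<close>, so \<open>n = CARD('x)\<close>; every \<open>n \<ge> 1\<close> occurs.
\<close>

type_synonym ('x, 'k) mpolynomial = "('x \<Rightarrow>\<^sub>0 nat) \<Rightarrow>\<^sub>0 'k"

definition mon_degree :: "('x::finite \<Rightarrow>\<^sub>0 nat) \<Rightarrow> nat" where
  "mon_degree m = (\<Sum>x\<in>UNIV. Poly_Mapping.lookup m x)"

text \<open>As usual, \<open>0\<close> is homogeneous of every degree.\<close>

definition homogeneous :: "nat \<Rightarrow> ('x::finite, 'k::zero) mpolynomial \<Rightarrow> bool" where
  "homogeneous d p \<longleftrightarrow> (\<forall>m\<in>Poly_Mapping.keys p. mon_degree m = d)"

definition homogeneous_component ::
    "nat \<Rightarrow> ('x::finite, 'k::comm_monoid_add) mpolynomial \<Rightarrow> ('x, 'k) mpolynomial" where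
  "homogeneous_component d p = (\<Sum>m\<in>{m\<in>Poly_Mapping.keys p. mon_degree m = d}. Poly_Mapping.single m (Poly_Mapping.lookup p m))"

text \<open>
  An ideal of a commutative ring is a submodule of the ring regarded as a module over itself, and
  the ideal generated by a set is its span in that module.
\<close>

lemma module_times: "module ((*) :: 'a \<Rightarrow> 'a \<Rightarrow> 'a::comm_ring_1)"
  by standard (simp_all add: algebra_simps)

abbreviation is_ideal :: "'a::comm_ring_1 set \<Rightarrow> bool" where
  "is_ideal \<equiv> module.subspace (*)"

abbreviation ideal_generated :: "'a::comm_ring_1 set \<Rightarrow> 'a set" where
  "ideal_generated \<equiv> module.span (*)"

definition ideal_product :: "'a::comm_ring_1 set \<Rightarrow> 'a set \<Rightarrow> 'a set" where
  "ideal_product I J = ideal_generated {a * b | a b. a \<in> I \<and> b \<in> J}"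

definition principal_ideal :: "'a::comm_ring_1 set \<Rightarrow> bool" where
  "principal_ideal L \<longleftrightarrow> (\<exists>f. L = ideal_generated {f})"

text \<open>
  The value is meaningful only for finitely generated \<open>L\<close>, i.e. for every ideal of a polynomial ring
  in finitely many variables over a field.
\<close>

definition min_gens :: "'a::comm_ring_1 set \<Rightarrow> nat" where
  "min_gens L = (LEAST k. \<exists>B. finite B \<and> card B = k \<and> ideal_generated B = L)"

definition graded_ideal :: "('x::finite, 'k::field) mpolynomial set \<Rightarrow> bool" where
  "graded_ideal L \<longleftrightarrow> is_ideal L \<and> (\<forall>p\<in>L. \<forall>d. homogeneous_component d p \<in> L)"

definition equigenerated :: "('x::finite, 'k::field) mpolynomial set \<Rightarrow> bool" where
  "equigenerated L \<longleftrightarrow> (\<exists>d B. (\<forall>p\<in>B. homogeneous d p) \<and> L = ideal_generated B)"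

end

theory Submission
  imports Defs "HOL-Computational_Algebra.Polynomial"
begin

text \<open>
  Let \<open>I\<close> and \<open>J\<close> be generated in degrees \<open>d\<close> and \<open>e\<close>, and let \<open>V\<close>, \<open>W\<close>, \<open>U\<close> be the vector spaces of
  homogeneous elements of degree \<open>d\<close>, \<open>e\<close>, \<open>d + e\<close> in \<open>I\<close>, \<open>J\<close>, \<open>I J\<close>. By Nakayama's argument the
  minimal number of generators of each ideal is the dimension of this space, and \<open>V W \<subseteq> U\<close>. So
  the claim is the inequality \<open>dim U \<ge> dim V + dim W - 1\<close>. It is an inequality on sumsets: the
  dimension of a space counts the leading monomials of its elements, leading monomials add under
  multiplication, and finite nonempty sets \<open>A\<close>, \<open>B\<close> in a totally ordered cancellative monoid
  satisfy \<open>|A + B| \<ge> |A| + |B| - 1\<close>.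

  A Kronecker substitution \<open>x\<^sub>i \<mapsto> t ^ (N ^ i)\<close> takes the place of a monomial order. It is a ring
  homomorphism to \<open>K[t]\<close>, and it sends the monomials of degree less than \<open>N\<close> to distinct powers of
  \<open>t\<close> (\<open>additive_monomial_code\<close>), so the degree of the image plays the role of the leading monomial
  and the sumset inequality is needed in the natural numbers only (\<open>card_sumset_ge\<close>).

  Dimensions themselves are bypassed. With \<open>A\<close>, \<open>B\<close>, \<open>C\<close> the sets of degrees that occur in the images
  of \<open>V\<close>, \<open>W\<close>, \<open>U\<close>, one element for each degree in \<open>A\<close> spans \<open>V\<close> and hence generates \<open>I\<close>, so
  \<open>\<mu>(I) \<le> |A|\<close> and likewise \<open>\<mu>(J) \<le> |B|\<close> (\<open>equigenerated_generators\<close>). In the other direction,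
  elements of distinct degrees are linearly independent, and any generating set of \<open>I J\<close>,
  homogeneous or not, has lowest-degree parts that span \<open>U\<close>
  (\<open>lowest_part_spanned_by_card_generators\<close>), so \<open>|C| \<le> \<mu>(I J)\<close>. As \<open>K[t]\<close> is a domain,
  \<open>A + B \<subseteq> C\<close>.

  The strict inequality for non-principal ideals follows because they need at least two generators.
\<close>

section \<open>Sumsets of natural numbers\<close>

text \<open>
  The translates \<open>Min A + B\<close> and \<open>A + Max B\<close> lie in the sumset, and they share only the point
  \<open>Min A + Max B\<close>, which is the largest of the first and the smallest of the second.
\<close>

lemma card_sumset_ge:
  fixes A B :: "nat set"
  assumes A: "finite A" "A \<noteq> {}" and B: "finite B" "B \<noteq> {}"
  shows "card A + card B \<le> card {a + b | a b. a \<in> A \<and> b \<in> B} + 1"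
proof -
  let ?S = "{a + b | a b. a \<in> A \<and> b \<in> B}"
  let ?X = "(\<lambda>b. Min A + b) ` B" and ?Y = "(\<lambda>a. a + Max B) ` A"
  have S: "?S = (\<lambda>(a, b). a + b) ` (A \<times> B)"
    by auto
  have fin: "finite ?S"
    unfolding S using A B by simp
  have "?X \<inter> ?Y \<subseteq> {Min A + Max B}"
  proof
    fix s assume "s \<in> ?X \<inter> ?Y"
    then obtain a b where "a \<in> A" "b \<in> B" "s = Min A + b" "s = a + Max B"
      by auto
    moreover have "Min A \<le> a" "b \<le> Max B"
      using A B \<open>a \<in> A\<close> \<open>b \<in> B\<close> by simp_all
    ultimately show "s \<in> {Min A + Max B}"
      by simp
  qed
  then have "card (?X \<inter> ?Y) \<le> card {Min A + Max B}"
    by (intro card_mono) auto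
  moreover have "card ?X = card B" "card ?Y = card A"
    by (simp_all add: card_image inj_on_def)
  moreover have "card ?X + card ?Y = card (?X \<union> ?Y) + card (?X \<inter> ?Y)"
    using A B by (intro card_Un_Int) auto
  moreover have "?X \<union> ?Y \<subseteq> ?S"
    using Min_in[OF A] Max_in[OF B] by auto
  then have "card (?X \<union> ?Y) \<le> card ?S"
    using fin by (rule card_mono[rotated])
  ultimately show ?thesis
    by simp
qed

section \<open>Ideals and minimal numbers of generators\<close>

interpretation ideal: module "(*) :: 'a \<Rightarrow> 'a \<Rightarrow> 'a::comm_ring_1"
  by (rule module_times)

lemma ideal_generated_0: "ideal_generated {0 :: 'a::comm_ring_1} = {0}"
  by (rule ideal.span_unique) (auto simp: ideal.subspace_def)

lemma ideal_product_generated: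
  fixes A B :: "'a::comm_ring_1 set"
  shows "ideal_product (ideal_generated A) (ideal_generated B)
    = ideal_generated {a * b | a b. a \<in> A \<and> b \<in> B}" (is "_ = ideal_generated ?G")
proof
  have one: "a * y \<in> ideal_generated ?G" if "a \<in> A" "y \<in> ideal_generated B" for a y
    using that(2)
  proof (induction rule: ideal.span_induct_alt)
    case base
    show ?case by (simp add: ideal.span_zero)
  next
    case (step c b y)
    have "a * b \<in> ideal_generated ?G"
      using step \<open>a \<in> A\<close> by (auto intro: ideal.span_base)
    then have "c * (a * b) + a * y \<in> ideal_generated ?G"
      using step by (intro ideal.span_add ideal.span_scale[of "a * b"])
    then show ?case by (simp only: distrib_left mult.left_commute)
  qed
  have two: "x * y \<in> ideal_generated ?G"
    if "x \<in> ideal_generated A" "y \<in> ideal_generated B" for x y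
    using that(1)
  proof (induction rule: ideal.span_induct_alt)
    case base
    show ?case by (simp add: ideal.span_zero)
  next
    case (step c a x)
    have "c * (a * y) + x * y \<in> ideal_generated ?G"
      using step one[OF _ that(2)] by (intro ideal.span_add ideal.span_scale[of "a * y"])
    then show ?case by (simp only: distrib_right mult.assoc)
  qed
  show "ideal_product (ideal_generated A) (ideal_generated B) \<subseteq> ideal_generated ?G"
    unfolding ideal_product_def
    by (rule ideal.span_minimal) (use two in \<open>auto simp: ideal.subspace_span\<close>)
  show "ideal_generated ?G \<subseteq> ideal_product (ideal_generated A) (ideal_generated B)"
    unfolding ideal_product_def
    by (rule ideal.span_mono) (auto intro: ideal.span_base)
qed

lemma min_gens_le:
  assumes "finite B" "ideal_generated B = L" "card B \<le> k"
  shows "min_gens L \<le> k"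
proof -
  have "min_gens L \<le> card B"
    unfolding min_gens_def by (rule Least_le) (use assms in blast)
  with assms show ?thesis by simp
qed

text \<open>
  The least number in \<open>min_gens\<close> is unspecified unless some finite set generates the ideal; with such
  a set at hand it is the size of an actual generating set.
\<close>

lemma min_gens_attained:
  assumes "finite B" "ideal_generated B = L"
  obtains C where "finite C" "card C = min_gens L" "ideal_generated C = L"
proof -
  have "\<exists>C. finite C \<and> card C = min_gens L \<and> ideal_generated C = L"
    unfolding min_gens_def by (rule LeastI_ex) (use assms in blast)
  with that show thesis by blast
qed

lemma min_gens_ge_2:
  assumes "finite B" "ideal_generated B = L" "\<not> principal_ideal L"
  shows "2 \<le> min_gens L"
proof (rule ccontr)
  assume "\<not> 2 \<le> min_gens L"
  moreover obtain C where C: "finite C" "card C = min_gens L" "ideal_generated C = L"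
    using min_gens_attained assms(1,2) by blast
  ultimately consider "card C = 0" | "card C = 1"
    by linarith
  then have "\<exists>f. L = ideal_generated {f}"
  proof cases
    case 1
    then have "L = {0}" using C by simp
    then have "L = ideal_generated {0}"
      by (simp add: ideal_generated_0)
    then show ?thesis ..
  next
    case 2
    then obtain f where "C = {f}" by (auto simp: card_1_singleton_iff)
    with C show ?thesis by auto
  qed
  with assms(3) show False
    unfolding principal_ideal_def by simp
qed

section \<open>The vector space of polynomials\<close>

text \<open>
  Scalars act as constant polynomials, so that every ideal is visibly a subspace.
\<close>

definition cscale :: "'k::field \<Rightarrow> ('a::comm_monoid_add \<Rightarrow>\<^sub>0 'k) \<Rightarrow> ('a \<Rightarrow>\<^sub>0 'k)" where
  "cscale c p = Poly_Mapping.single 0 c * p"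

interpretation lin: vector_space "cscale :: 'k::field \<Rightarrow> ('a::comm_monoid_add \<Rightarrow>\<^sub>0 'k) \<Rightarrow> _"
  by standard
    (simp_all add: cscale_def distrib_left distrib_right single_add mult_single flip: mult.assoc)

lemma subspace_if_ideal: "is_ideal L \<Longrightarrow> lin.subspace L"
  by (simp add: lin.subspace_def ideal.subspace_def cscale_def)

lemma span_subset_ideal_generated: "lin.span P \<subseteq> ideal_generated P"
  by (rule lin.span_minimal)
    (auto intro: ideal.span_base subspace_if_ideal ideal.subspace_span)

section \<open>Substituting powers of one variable for monomials\<close>

text \<open>
  The image of \<open>p\<close> under the substitution that replaces each monomial \<open>m\<close> by \<open>t ^ \<phi> m\<close>. For additive
  \<open>\<phi>\<close> it is a homomorphism of \<open>K\<close>-algebras.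
\<close>

definition kronecker :: "('a \<Rightarrow> nat) \<Rightarrow> ('a \<Rightarrow>\<^sub>0 'k::field) \<Rightarrow> 'k poly" where
  "kronecker \<phi> p = (\<Sum>m\<in>Poly_Mapping.keys p. monom (Poly_Mapping.lookup p m) (\<phi> m))"

lemma kronecker_superset:
  assumes "finite M" "Poly_Mapping.keys p \<subseteq> M"
  shows "kronecker \<phi> p = (\<Sum>m\<in>M. monom (Poly_Mapping.lookup p m) (\<phi> m))"
  unfolding kronecker_def
  by (rule sum.mono_neutral_left) (use assms in \<open>auto simp: in_keys_iff\<close>)

lemma kronecker_add: "kronecker \<phi> (p + q) = kronecker \<phi> p + kronecker \<phi> q"
proof -
  let ?M = "Poly_Mapping.keys p \<union> Poly_Mapping.keys q"
  show ?thesis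
    using keys_add[of p q]
    by (simp add: kronecker_superset[of ?M] lookup_add sum.distrib flip: add_monom)
qed

lemma kronecker_zero [simp]: "kronecker \<phi> 0 = 0"
  by (simp add: kronecker_def)

lemma kronecker_sum: "kronecker \<phi> (\<Sum>i\<in>A. f i) = (\<Sum>i\<in>A. kronecker \<phi> (f i))"
  by (induction A rule: infinite_finite_induct) (simp_all add: kronecker_add)

lemma kronecker_single [simp]: "kronecker \<phi> (Poly_Mapping.single m c) = monom c (\<phi> m)"
  by (cases "c = 0") (simp_all add: kronecker_def)

lemma sum_single_lookup:
  "(\<Sum>m\<in>Poly_Mapping.keys p. Poly_Mapping.single m (Poly_Mapping.lookup p m)) = p"
  by (rule poly_mapping_eqI)
    (auto simp: lookup_sum lookup_single when_def in_keys_iff)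

lemma kronecker_mult:
  fixes \<phi> :: "'a::comm_monoid_add \<Rightarrow> nat" and p q :: "'a \<Rightarrow>\<^sub>0 'k::field"
  assumes "\<And>m n. \<phi> (m + n) = \<phi> m + \<phi> n"
  shows "kronecker \<phi> (p * q) = kronecker \<phi> p * kronecker \<phi> q"
proof -
  let ?s = "\<lambda>(r :: 'a \<Rightarrow>\<^sub>0 'k) m. Poly_Mapping.single m (Poly_Mapping.lookup r m)"
  have "p * q = (\<Sum>m\<in>Poly_Mapping.keys p. ?s p m) * (\<Sum>n\<in>Poly_Mapping.keys q. ?s q n)"
    by (simp add: sum_single_lookup)
  also have "kronecker \<phi> \<dots> = kronecker \<phi> p * kronecker \<phi> q"
    by (simp add: sum_product kronecker_sum mult_single mult_monom assms kronecker_def[of _ p] kronecker_def[of _ q])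
  finally show ?thesis .
qed

lemma kronecker_cscale:
  fixes \<phi> :: "'a::comm_monoid_add \<Rightarrow> nat"
  assumes add: "\<And>m n. \<phi> (m + n) = \<phi> m + \<phi> n"
  shows "kronecker \<phi> (cscale c p) = smult c (kronecker \<phi> p)"
proof -
  have "\<phi> 0 = 0"
    using add[of 0 0] by simp
  then show ?thesis
    by (simp add: cscale_def kronecker_mult[OF add] monom_0)
qed

lemma kronecker_diff:
  fixes p q :: "'a \<Rightarrow>\<^sub>0 'k::field"
  shows "kronecker \<phi> (p - q) = kronecker \<phi> p - kronecker \<phi> q"
  using kronecker_add[of \<phi> "p - q" q] by simp

text \<open>
  Distinct monomials of \<open>p\<close> go to distinct powers of \<open>t\<close>, so no coefficients can cancel.
\<close>

lemma kronecker_eq_0D: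
  assumes "inj_on \<phi> (Poly_Mapping.keys p)" "kronecker \<phi> p = 0"
  shows "p = 0"
proof (rule ccontr)
  assume "p \<noteq> 0"
  then obtain m where m: "m \<in> Poly_Mapping.keys p"
    using keys_eq_empty[of p] by blast
  have "coeff (kronecker \<phi> p) (\<phi> m)
      = (\<Sum>m'\<in>Poly_Mapping.keys p. if m' = m then Poly_Mapping.lookup p m' else 0)"
    unfolding kronecker_def coeff_sum
    by (rule sum.cong) (use assms(1) m in \<open>auto simp: inj_on_def\<close>)
  also have "\<dots> = Poly_Mapping.lookup p m"
    using m by simp
  finally show False
    using assms(2) m by (simp add: in_keys_iff)
qed

lemma degree_kronecker_le:
  assumes "\<And>m. m \<in> Poly_Mapping.keys p \<Longrightarrow> \<phi> m \<le> k"
  shows "degree (kronecker \<phi> p) \<le> k"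
  unfolding kronecker_def
  by (rule degree_sum_le) (use assms in \<open>auto intro: order_trans[OF degree_monom_le]\<close>)

section \<open>Degrees occurring in a space of polynomials\<close>

definition kronecker_degrees :: "('a \<Rightarrow> nat) \<Rightarrow> ('a \<Rightarrow>\<^sub>0 'k::field) set \<Rightarrow> nat set" where
  "kronecker_degrees \<phi> V = {degree (kronecker \<phi> v) | v. v \<in> V \<and> kronecker \<phi> v \<noteq> 0}"

text \<open>
  This is Gaussian elimination: choose one element for each degree. Subtracting a multiple of the
  element that has the same degree lowers the degree of a given vector, until the image, and hence
  the vector, is zero.
\<close>

lemma spanned_by_degree_representatives:
  fixes \<phi> :: "'a::comm_monoid_add \<Rightarrow> nat" and V :: "('a \<Rightarrow>\<^sub>0 'k::field) set"
  assumes add: "\<And>m n. \<phi> (m + n) = \<phi> m + \<phi> n"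
    and sub: "lin.subspace V"
    and ker: "\<And>v. v \<in> V \<Longrightarrow> kronecker \<phi> v = 0 \<Longrightarrow> v = 0"
    and fin: "finite (kronecker_degrees \<phi> V)"
  obtains P where "finite P" "P \<subseteq> V" "card P \<le> card (kronecker_degrees \<phi> V)" "V \<subseteq> lin.span P"
proof -
  have "\<forall>a\<in>kronecker_degrees \<phi> V. \<exists>v. v \<in> V \<and> kronecker \<phi> v \<noteq> 0 \<and> degree (kronecker \<phi> v) = a"
    by (auto simp: kronecker_degrees_def)
  then obtain r where r: "\<And>a. a \<in> kronecker_degrees \<phi> V \<Longrightarrow>
      r a \<in> V \<and> kronecker \<phi> (r a) \<noteq> 0 \<and> degree (kronecker \<phi> (r a)) = a"
    by metis
  let ?P = "r ` kronecker_degrees \<phi> V"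
  have "v \<in> lin.span ?P" if "v \<in> V" for v
    using that
  proof (induction "degree (kronecker \<phi> v)" arbitrary: v rule: less_induct)
    case less
    show ?case
    proof (cases "kronecker \<phi> v = 0")
      case True
      then show ?thesis using ker less.prems lin.span_zero by metis
    next
      case False
      define a where "a = degree (kronecker \<phi> v)"
      have a: "a \<in> kronecker_degrees \<phi> V"
        using False less.prems by (auto simp: a_def kronecker_degrees_def)
      (* Subtracting c times the representative cancels the leading coefficient. *)
      define c where "c = lead_coeff (kronecker \<phi> v) / lead_coeff (kronecker \<phi> (r a))"
      define w where "w = v - cscale c (r a)"
      have w: "kronecker \<phi> w = kronecker \<phi> v - smult c (kronecker \<phi> (r a))"
        by (simp add: w_def kronecker_diff kronecker_cscale[OF add])
      have "w \<in> V"
        using r[OF a] less.prems sub by (simp add: w_def lin.subspace_diff lin.subspace_scale)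
      have "coeff (kronecker \<phi> (r a)) a \<noteq> 0"
        using r[OF a] leading_coeff_0_iff by metis
      then have "coeff (kronecker \<phi> w) a = 0"
        using r[OF a] by (simp add: w c_def flip: a_def)
      moreover have "degree (kronecker \<phi> w) \<le> a"
        unfolding w
        by (rule degree_diff_le) (use r[OF a] in \<open>auto simp: a_def intro: order_trans[OF degree_smult_le]\<close>)
      ultimately have "kronecker \<phi> w = 0 \<or> degree (kronecker \<phi> w) < a"
        by (metis leading_coeff_0_iff le_neq_implies_less)
      then have "w \<in> lin.span ?P"
        using ker[OF \<open>w \<in> V\<close>] less.hyps[OF _ \<open>w \<in> V\<close>] lin.span_zero a_def by metis
      then have "w + cscale c (r a) \<in> lin.span ?P"
        using a by (intro lin.span_add lin.span_scale) (auto intro: lin.span_base)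
      then show ?thesis by (simp add: w_def)
    qed
  qed
  moreover have "?P \<subseteq> V" using r by auto
  ultimately show thesis
    using that[of ?P] fin card_image_le[OF fin] by auto
qed

text \<open>
  In a nontrivial relation, the vector of largest degree among those with nonzero coefficient is the
  only one that contributes to its leading coefficient, so nothing cancels it.
\<close>

lemma independent_if_distinct_degrees:
  fixes \<phi> :: "'a::comm_monoid_add \<Rightarrow> nat" and S :: "('a \<Rightarrow>\<^sub>0 'k::field) set"
  assumes add: "\<And>m n. \<phi> (m + n) = \<phi> m + \<phi> n"
    and nz: "\<And>s. s \<in> S \<Longrightarrow> kronecker \<phi> s \<noteq> 0"
    and inj: "inj_on (\<lambda>s. degree (kronecker \<phi> s)) S"
  shows "\<not> lin.dependent S"
proof
  let ?d = "\<lambda>s. degree (kronecker \<phi> s)"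
  assume "lin.dependent S"
  then obtain T u where T: "finite T" "T \<subseteq> S" "(\<Sum>v\<in>T. cscale (u v) v) = 0" "\<exists>v\<in>T. u v \<noteq> 0"
    unfolding lin.dependent_explicit by blast
  define T' where "T' = {v \<in> T. u v \<noteq> 0}"
  have T': "finite T'" "T' \<noteq> {}" "T' \<subseteq> S"
    using T by (auto simp: T'_def)
  obtain t where t: "t \<in> T'" and max: "\<And>v. v \<in> T' \<Longrightarrow> ?d v \<le> ?d t"
    using T' Max_in[of "?d ` T'"] Max_ge[of "?d ` T'"] by fastforce
  have "(\<Sum>v\<in>T'. cscale (u v) v) = (\<Sum>v\<in>T. cscale (u v) v)"
    by (rule sum.mono_neutral_left) (use T in \<open>auto simp: T'_def\<close>)
  then have "kronecker \<phi> (\<Sum>v\<in>T'. cscale (u v) v) = 0"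
    using T(3) by simp
  then have "(\<Sum>v\<in>T'. smult (u v) (kronecker \<phi> v)) = 0"
    by (simp add: kronecker_sum kronecker_cscale[OF add])
  then have "0 = (\<Sum>v\<in>T'. u v * coeff (kronecker \<phi> v) (?d t))"
    by (metis (no_types, lifting) coeff_0 coeff_smult coeff_sum sum.cong)
  also have "\<dots> = (\<Sum>v\<in>T'. if v = t then u t * lead_coeff (kronecker \<phi> t) else 0)"
  proof (rule sum.cong)
    fix v assume v: "v \<in> T'"
    show "u v * coeff (kronecker \<phi> v) (?d t)
        = (if v = t then u t * lead_coeff (kronecker \<phi> t) else 0)"
    proof (cases "v = t")
      case False
      then have "?d v \<noteq> ?d t"
        using inj v t T' by (auto simp: inj_on_def)
      then have "?d v < ?d t" using max[OF v] by simp
      then show ?thesis using False by (simp add: coeff_eq_0)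
    qed simp
  qed simp
  also have "\<dots> = u t * lead_coeff (kronecker \<phi> t)"
    using t T' by simp
  finally show False
    using t T' nz by (auto simp: T'_def)
qed

text \<open>
  Together with \<open>spanned_by_degree_representatives\<close> this says that the number of degrees is the
  dimension of \<open>V\<close> when the substitution is injective on \<open>V\<close>.
\<close>

lemma card_kronecker_degrees_le:
  fixes \<phi> :: "'a::comm_monoid_add \<Rightarrow> nat" and V :: "('a \<Rightarrow>\<^sub>0 'k::field) set"
  assumes add: "\<And>m n. \<phi> (m + n) = \<phi> m + \<phi> n"
    and T: "finite T" "V \<subseteq> lin.span T"
  shows "finite (kronecker_degrees \<phi> V) \<and> card (kronecker_degrees \<phi> V) \<le> card T"
proof -
  let ?d = "\<lambda>s. degree (kronecker \<phi> s)"
  have deg: "kronecker_degrees \<phi> V = ?d ` {v \<in> V. kronecker \<phi> v \<noteq> 0}"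
    by (auto simp: kronecker_degrees_def)
  then obtain S where S: "S \<subseteq> {v \<in> V. kronecker \<phi> v \<noteq> 0}" "inj_on ?d S"
    "kronecker_degrees \<phi> V = ?d ` S"
    using subset_image_inj[of "kronecker_degrees \<phi> V" ?d "{v \<in> V. kronecker \<phi> v \<noteq> 0}"] by auto
  have "\<not> lin.dependent S"
    by (rule independent_if_distinct_degrees[OF add, of S]) (use S in auto)
  then have "finite S \<and> card S \<le> card T"
    using S T by (intro lin.independent_span_bound) auto
  then show ?thesis
    unfolding S(3) by (simp add: card_image[OF S(2)])
qed

section \<open>Digit expansions as additive codes of monomials\<close>

lemma digits_unique:
  fixes a b :: "nat \<Rightarrow> nat"
  assumes "\<And>i. i < n \<Longrightarrow> a i < N" "\<And>i. i < n \<Longrightarrow> b i < N"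
    and "(\<Sum>i<n. a i * N ^ i) = (\<Sum>i<n. b i * N ^ i)" and "i < n"
  shows "a i = b i"
  using assms
proof (induction n arbitrary: a b i)
  case (Suc n)
  have split: "(\<Sum>i<Suc n. f i * N ^ i) = f 0 + N * (\<Sum>i<n. f (Suc i) * N ^ i)" for f :: "nat \<Rightarrow> nat"
    by (simp add: sum.lessThan_Suc_shift sum_distrib_left algebra_simps del: sum.lessThan_Suc)
  have eq: "a 0 + N * (\<Sum>i<n. a (Suc i) * N ^ i) = b 0 + N * (\<Sum>i<n. b (Suc i) * N ^ i)"
    using Suc.prems(3) unfolding split .
  have lt: "a 0 < N" "b 0 < N"
    using Suc.prems(1,2) by auto
  then have 0: "a 0 = b 0"
    using arg_cong[OF eq, of "\<lambda>x. x mod N"] by simp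
  then have "(\<Sum>i<n. a (Suc i) * N ^ i) = (\<Sum>i<n. b (Suc i) * N ^ i)"
    using eq lt by simp
  then have "a (Suc j) = b (Suc j)" if "j < n" for j
    using Suc.IH[of "\<lambda>i. a (Suc i)" "\<lambda>i. b (Suc i)" j] Suc.prems(1,2) that by auto
  with 0 Suc.prems(4) show ?case
    by (cases i) auto
qed simp

lemma lookup_le_mon_degree: "Poly_Mapping.lookup m x \<le> mon_degree m"
  unfolding mon_degree_def by (rule member_le_sum) auto

text \<open>
  The exponents of a monomial of degree less than \<open>N\<close> are themselves less than \<open>N\<close>, so they can be
  read as digits in base \<open>N\<close>. Adding exponent vectors adds these numbers because the value of a digit
  expansion is linear in the digits, whether or not they are in range.
\<close>

lemma additive_monomial_code:
  obtains \<phi> :: "('x::finite \<Rightarrow>\<^sub>0 nat) \<Rightarrow> nat"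
  where "\<And>m n. \<phi> (m + n) = \<phi> m + \<phi> n"
    and "inj_on \<phi> {m. mon_degree m < N}"
proof -
  obtain g :: "nat \<Rightarrow> 'x" where g: "bij_betw g {..<card (UNIV :: 'x set)} UNIV"
    using ex_bij_betw_nat_finite[of "UNIV :: 'x set"] by (auto simp: atLeast0LessThan)
  define \<phi> where "\<phi> = (\<lambda>m :: 'x \<Rightarrow>\<^sub>0 nat. \<Sum>i<card (UNIV :: 'x set). Poly_Mapping.lookup m (g i) * N ^ i)"
  have "\<phi> (m + n) = \<phi> m + \<phi> n" for m n
    by (simp add: \<phi>_def lookup_add sum.distrib algebra_simps)
  moreover have "inj_on \<phi> {m. mon_degree m < N}"
  proof (rule inj_onI)
    fix m n :: "'x \<Rightarrow>\<^sub>0 nat"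
    assume mn: "m \<in> {m. mon_degree m < N}" "n \<in> {m. mon_degree m < N}" and eq: "\<phi> m = \<phi> n"
    have "Poly_Mapping.lookup m (g i) = Poly_Mapping.lookup n (g i)" if "i < card (UNIV :: 'x set)" for i
      by (rule digits_unique[where n = "card (UNIV :: 'x set)" and N = N])
        (use that eq mn lookup_le_mon_degree[THEN le_less_trans] in \<open>auto simp: \<phi>_def\<close>)
    moreover have "\<exists>i<card (UNIV :: 'x set). x = g i" for x
      using g by (auto simp: bij_betw_def image_iff set_eq_iff)
    ultimately have "Poly_Mapping.lookup m x = Poly_Mapping.lookup n x" for x
      by metis
    then show "m = n"
      by (rule poly_mapping_eqI)
  qed
  ultimately show thesis
    using that by blast
qed

section \<open>Lowest-degree parts\<close>

text \<open>
  The polynomials with \<open>order_ge d\<close> form the \<open>d\<close>-th power of the ideal generated by the variables.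
\<close>

definition order_ge :: "nat \<Rightarrow> ('x::finite, 'k::zero) mpolynomial \<Rightarrow> bool" where
  "order_ge d p \<longleftrightarrow> (\<forall>m\<in>Poly_Mapping.keys p. d \<le> mon_degree m)"

lemma mon_degree_add: "mon_degree (m + n) = mon_degree m + mon_degree n"
  by (simp add: mon_degree_def lookup_add sum.distrib)

lemma mon_degree_eq_0_iff: "mon_degree m = 0 \<longleftrightarrow> m = 0"
  by (auto simp: mon_degree_def intro: poly_mapping_eqI)

lemma order_ge_add: "order_ge d p \<Longrightarrow> order_ge d q \<Longrightarrow> order_ge d (p + q)"
  using keys_add[of p q] unfolding order_ge_def by blast

lemma order_ge_mult:
  fixes p q :: "('x::finite, 'k::field) mpolynomial"
  assumes "order_ge d p" "order_ge e q"
  shows "order_ge (d + e) (p * q)"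
  unfolding order_ge_def
proof
  fix m assume "m \<in> Poly_Mapping.keys (p * q)"
  then obtain a b where "m = a + b" "a \<in> Poly_Mapping.keys p" "b \<in> Poly_Mapping.keys q"
    using keys_mult[of p q] by blast
  with assms show "d + e \<le> mon_degree m"
    by (auto simp: order_ge_def mon_degree_add intro: add_mono)
qed

lemma order_ge_Suc_0_minus_constant:
  fixes r :: "('x::finite, 'k::field) mpolynomial"
  shows "order_ge (Suc 0) (r - Poly_Mapping.single 0 (Poly_Mapping.lookup r 0))"
  unfolding order_ge_def
proof
  fix m assume "m \<in> Poly_Mapping.keys (r - Poly_Mapping.single 0 (Poly_Mapping.lookup r 0))"
  then have "m \<noteq> 0"
    by (auto simp: in_keys_iff lookup_minus)
  then show "Suc 0 \<le> mon_degree m"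
    using mon_degree_eq_0_iff[of m] by simp
qed

lemma homogeneous_mult:
  fixes p q :: "('x::finite, 'k::field) mpolynomial"
  assumes "homogeneous d p" "homogeneous e q"
  shows "homogeneous (d + e) (p * q)"
  unfolding homogeneous_def
proof
  fix m assume "m \<in> Poly_Mapping.keys (p * q)"
  then obtain a b where "m = a + b" "a \<in> Poly_Mapping.keys p" "b \<in> Poly_Mapping.keys q"
    using keys_mult[of p q] by blast
  with assms show "mon_degree m = d + e"
    by (auto simp: homogeneous_def mon_degree_add)
qed

lemma subspace_homogeneous:
  "lin.subspace {p :: ('x::finite, 'k::field) mpolynomial. homogeneous d p}"
proof (rule lin.subspaceI)
  fix p q :: "('x, 'k) mpolynomial" and c :: 'k
  show "0 \<in> {p :: ('x, 'k) mpolynomial. homogeneous d p}"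
    by (simp add: homogeneous_def)
  show "p + q \<in> {p. homogeneous d p}" if "p \<in> {p. homogeneous d p}" "q \<in> {p. homogeneous d p}"
    using that keys_add[of p q] by (auto simp: homogeneous_def)
  have "homogeneous 0 (Poly_Mapping.single (0 :: 'x \<Rightarrow>\<^sub>0 nat) c)"
    by (auto simp: homogeneous_def mon_degree_eq_0_iff split: if_splits)
  then show "cscale c p \<in> {p. homogeneous d p}" if "p \<in> {p. homogeneous d p}"
    using that homogeneous_mult[of 0 _ d p] by (simp add: cscale_def)
qed

lemma homogeneous_order_ge_eq_0:
  assumes "homogeneous d p" "order_ge (Suc d) p"
  shows "p = 0"
proof -
  have "Poly_Mapping.keys p = {}"
    using assms by (force simp: homogeneous_def order_ge_def)
  then show ?thesis by simp
qed

text \<open>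
  Modulo polynomials of order greater than \<open>d\<close>, a ring element acts on homogeneous polynomials of
  degree \<open>d\<close> only through its constant term. Hence a subspace of such polynomials is closed under
  multiplication by arbitrary ring elements modulo higher order. This replaces Nakayama's lemma.
\<close>

lemma is_ideal_congruent_lowest_part:
  fixes H :: "('x::finite, 'k::field) mpolynomial set"
  assumes H: "lin.subspace H" and hom: "\<And>g. g \<in> H \<Longrightarrow> homogeneous d g"
  shows "is_ideal {p. \<exists>g\<in>H. order_ge (Suc d) (p - g)}" (is "is_ideal ?L")
proof (rule ideal.subspaceI)
  show "0 \<in> ?L"
    using lin.subspace_0[OF H] by (auto simp: order_ge_def intro!: bexI[of _ 0])
next
  fix p q assume "p \<in> ?L" "q \<in> ?L"
  then obtain g h where "g \<in> H" "h \<in> H" "order_ge (Suc d) (p - g)" "order_ge (Suc d) (q - h)"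
    by blast
  then have "g + h \<in> H" "order_ge (Suc d) ((p + q) - (g + h))"
    using lin.subspace_add[OF H] order_ge_add[of "Suc d" "p - g" "q - h"]
    by (simp_all add: algebra_simps)
  then show "p + q \<in> ?L" by blast
next
  fix r p :: "('x, 'k) mpolynomial" assume "p \<in> ?L"
  then obtain g where g: "g \<in> H" "order_ge (Suc d) (p - g)"
    by blast
  let ?c = "Poly_Mapping.lookup r 0"
  have "order_ge (0 + Suc d) (r * (p - g))"
    using g by (intro order_ge_mult) (simp_all add: order_ge_def)
  moreover have "order_ge d g"
    using hom[OF g(1)] by (simp add: homogeneous_def order_ge_def)
  then have "order_ge (Suc 0 + d) ((r - Poly_Mapping.single 0 ?c) * g)"
    by (intro order_ge_mult order_ge_Suc_0_minus_constant)
  ultimately have "order_ge (Suc d) (r * (p - g) + (r - Poly_Mapping.single 0 ?c) * g)"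
    by (intro order_ge_add) simp_all
  then have "order_ge (Suc d) (r * p - cscale ?c g)"
    by (simp add: cscale_def algebra_simps)
  then show "r * p \<in> ?L"
    using lin.subspace_scale[OF H g(1)] by blast
qed

text \<open>
  The spanning set consists of the degree-\<open>d\<close> parts of the elements of \<open>B\<close>. All elements of the
  ideal have order at least \<open>d\<close>, so each of them is congruent to such a part modulo higher order;
  by \<open>is_ideal_congruent_lowest_part\<close> every element of the ideal is then congruent to a linear
  combination of these parts. For a homogeneous element of degree \<open>d\<close> the congruence is an equality.
\<close>

lemma lowest_part_spanned_by_card_generators:
  fixes B S :: "('x::finite, 'k::field) mpolynomial set"
  assumes S: "\<And>s. s \<in> S \<Longrightarrow> homogeneous d s"
    and B: "finite B" "ideal_generated B = ideal_generated S"
  obtains T where "finite T" "card T \<le> card B"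
    "{u \<in> ideal_generated S. homogeneous d u} \<subseteq> lin.span T"
proof -
  let ?L = "\<lambda>H. {p :: ('x, 'k) mpolynomial. \<exists>g\<in>H. order_ge (Suc d) (p - g)}"
  have "S \<subseteq> ?L {p. homogeneous d p}"
    using S by (force simp: order_ge_def)
  then have "ideal_generated S \<subseteq> ?L {p. homogeneous d p}"
    by (intro ideal.span_minimal is_ideal_congruent_lowest_part subspace_homogeneous) auto
  moreover have "B \<subseteq> ideal_generated S"
    using B ideal.span_superset by blast
  ultimately have "\<forall>b\<in>B. \<exists>g. homogeneous d g \<and> order_ge (Suc d) (b - g)"
    by blast
  then obtain h where h: "\<And>b. b \<in> B \<Longrightarrow> homogeneous d (h b) \<and> order_ge (Suc d) (b - h b)"
    by metis
  have hom: "homogeneous d g" if "g \<in> lin.span (h ` B)" for g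
    using lin.span_minimal[OF _ subspace_homogeneous[of d], of "h ` B"] h that by auto
  have "B \<subseteq> ?L (lin.span (h ` B))"
    using h by (auto intro: lin.span_base)
  then have gen: "ideal_generated B \<subseteq> ?L (lin.span (h ` B))"
    by (intro ideal.span_minimal is_ideal_congruent_lowest_part hom lin.subspace_span)
  have "u \<in> lin.span (h ` B)" if u: "u \<in> ideal_generated S" "homogeneous d u" for u
  proof -
    obtain g where g: "g \<in> lin.span (h ` B)" "order_ge (Suc d) (u - g)"
      using gen u B by auto
    have "homogeneous d (u - g)"
      using lin.subspace_diff[OF subspace_homogeneous[of d]] u hom[OF g(1)] by auto
    then have "u - g = 0"
      using g by (intro homogeneous_order_ge_eq_0)
    with g show ?thesis by simp
  qed
  then show thesis
    using that[of "h ` B"] B by (auto simp: card_image_le)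
qed

section \<open>Products of equigenerated ideals\<close>

text \<open>
  There are only finitely many monomials of a given degree.
\<close>

lemma finite_kronecker_degrees_homogeneous:
  fixes V :: "('x::finite, 'k::field) mpolynomial set"
  assumes "\<And>v. v \<in> V \<Longrightarrow> homogeneous d v"
  shows "finite (kronecker_degrees \<phi> V)"
proof -
  let ?M = "{m :: 'x \<Rightarrow>\<^sub>0 nat. mon_degree m = d}"
  have "finite (Poly_Mapping.lookup ` ?M)"
    by (rule finite_subset[OF _ finite_set_of_finite_funs[of UNIV "{..d}" 0]])
      (auto simp: lookup_le_mon_degree)
  then have "finite ?M"
    by (rule finite_imageD) (auto simp: inj_on_def poly_mapping_eqI)
  then have bound: "\<phi> m \<le> Max (\<phi> ` ?M)" if "mon_degree m = d" for m
    using that by simp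
  have "degree (kronecker \<phi> v) \<le> Max (\<phi> ` ?M)" if "v \<in> V" for v
    by (rule degree_kronecker_le) (use assms[OF that] bound in \<open>simp add: homogeneous_def\<close>)
  then have "kronecker_degrees \<phi> V \<subseteq> {..Max (\<phi> ` ?M)}"
    unfolding kronecker_degrees_def by blast
  then show ?thesis
    by (rule finite_subset) simp
qed

text \<open>
  The homogeneous elements of degree \<open>d\<close> include the given generators, so any subset that spans
  their space generates the ideal.
\<close>

lemma equigenerated_generators:
  fixes S :: "('x::finite, 'k::field) mpolynomial set" and \<phi> :: "('x \<Rightarrow>\<^sub>0 nat) \<Rightarrow> nat"
  assumes add: "\<And>m n. \<phi> (m + n) = \<phi> m + \<phi> n"
    and inj: "inj_on \<phi> {m. mon_degree m = d}"
    and S: "\<And>s. s \<in> S \<Longrightarrow> homogeneous d s"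
    and nz: "ideal_generated S \<noteq> {0}"
  defines "A \<equiv> kronecker_degrees \<phi> {v \<in> ideal_generated S. homogeneous d v}"
  obtains P where "finite P" "card P \<le> card A" "ideal_generated P = ideal_generated S"
    "finite A" "A \<noteq> {}"
proof -
  let ?V = "{v \<in> ideal_generated S. homogeneous d v}"
  have ker: "v = 0" if "v \<in> ?V" "kronecker \<phi> v = 0" for v
    by (rule kronecker_eq_0D) (use that inj in \<open>auto simp: homogeneous_def intro: inj_on_subset\<close>)
  have fin: "finite A"
    unfolding A_def by (rule finite_kronecker_degrees_homogeneous) auto
  have "?V = ideal_generated S \<inter> {v. homogeneous d v}"
    by auto
  then have sub: "lin.subspace ?V"
    by (simp add: lin.subspace_inter subspace_if_ideal subspace_homogeneous ideal.subspace_span)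
  obtain P where P: "finite P" "P \<subseteq> ?V" "card P \<le> card A" "?V \<subseteq> lin.span P"
    using spanned_by_degree_representatives[OF add sub ker] fin unfolding A_def by blast
  have SV: "S \<subseteq> ?V"
    using S by (auto intro: ideal.span_base)
  have "ideal_generated S \<subseteq> ideal_generated P"
    by (rule ideal.span_minimal)
      (use SV P span_subset_ideal_generated ideal.subspace_span in blast)+
  moreover have "ideal_generated P \<subseteq> ideal_generated S"
    by (rule ideal.span_minimal) (use P in \<open>auto simp: ideal.subspace_span\<close>)
  moreover have "\<exists>s\<in>S. s \<noteq> 0"
  proof (rule ccontr)
    assume "\<not> (\<exists>s\<in>S. s \<noteq> 0)"
    then have "ideal_generated S \<subseteq> ideal_generated {0}"
      by (intro ideal.span_mono) auto
    with nz ideal.span_zero[of S] show False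
      by (auto simp: ideal_generated_0)
  qed
  then have "A \<noteq> {}"
    using SV ker unfolding A_def kronecker_degrees_def by blast
  ultimately show thesis
    using that P fin by blast
qed

theorem theorem1p6:
  fixes I J :: "('x::finite, 'k::field) mpolynomial set"
  assumes "graded_ideal I" and "equigenerated I" and "I \<noteq> {0}"
    and "graded_ideal J" and "equigenerated J" and "J \<noteq> {0}"
  shows "int (min_gens (ideal_product I J)) \<ge> int (min_gens I) + int (min_gens J) - 1
    \<and> (\<not> principal_ideal I \<and> \<not> principal_ideal J \<longrightarrow>
        min_gens (ideal_product I J) > max (min_gens I) (min_gens J))"
proof -
  obtain d S where S: "\<And>s. s \<in> S \<Longrightarrow> homogeneous d s" "I = ideal_generated S"
    using assms(2) unfolding equigenerated_def by blast
  obtain e T where T: "\<And>t. t \<in> T \<Longrightarrow> homogeneous e t" "J = ideal_generated T"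
    using assms(5) unfolding equigenerated_def by blast
  obtain \<phi> :: "('x \<Rightarrow>\<^sub>0 nat) \<Rightarrow> nat" where add: "\<And>m n. \<phi> (m + n) = \<phi> m + \<phi> n"
    and inj: "inj_on \<phi> {m. mon_degree m < Suc (d + e)}"
    using additive_monomial_code[of "Suc (d + e)"] by blast
  define A where "A = kronecker_degrees \<phi> {v \<in> I. homogeneous d v}"
  define B where "B = kronecker_degrees \<phi> {w \<in> J. homogeneous e w}"
  define C where "C = kronecker_degrees \<phi> {u \<in> ideal_product I J. homogeneous (d + e) u}"
  have injd: "inj_on \<phi> {m. mon_degree m = d}" and inje: "inj_on \<phi> {m. mon_degree m = e}"
    using inj by (auto elim: inj_on_subset)
  obtain P where P: "finite P" "card P \<le> card A" "ideal_generated P = I" "finite A" "A \<noteq> {}"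
    using equigenerated_generators[OF add injd S(1)] assms(3) unfolding A_def S(2) by blast
  obtain Q where Q: "finite Q" "card Q \<le> card B" "ideal_generated Q = J" "finite B" "B \<noteq> {}"
    using equigenerated_generators[OF add inje T(1)] assms(6) unfolding B_def T(2) by blast

  let ?G = "{s * t | s t. s \<in> S \<and> t \<in> T}"
  have IJ: "ideal_product I J = ideal_generated ?G"
    unfolding S(2) T(2) by (rule ideal_product_generated)
  have G: "homogeneous (d + e) g" if "g \<in> ?G" for g
    using that S(1) T(1) homogeneous_mult by blast
  have "{p * q | p q. p \<in> P \<and> q \<in> Q} = (\<lambda>(p, q). p * q) ` (P \<times> Q)"
    by auto
  then have "finite {p * q | p q. p \<in> P \<and> q \<in> Q}"
    using P Q by simp
  moreover have "ideal_generated {p * q | p q. p \<in> P \<and> q \<in> Q} = ideal_product I J"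
    using ideal_product_generated[of P Q] P Q by simp
  ultimately obtain R where R: "finite R" "card R = min_gens (ideal_product I J)"
    "ideal_generated R = ideal_product I J"
    by (rule min_gens_attained)
  obtain U where U: "finite U" "card U \<le> card R"
    "{u \<in> ideal_generated ?G. homogeneous (d + e) u} \<subseteq> lin.span U"
    by (rule lowest_part_spanned_by_card_generators[OF G R(1) R(3)[unfolded IJ]])
  have C: "finite C" "card C \<le> min_gens (ideal_product I J)"
    using card_kronecker_degrees_le[OF add U(1,3)] U(2) R(2) unfolding C_def IJ by simp_all

  (* A product of nonzero images in the domain K[t] is nonzero, and degrees add. *)
  have "{a + b | a b. a \<in> A \<and> b \<in> B} \<subseteq> C"
  proof
    fix k assume "k \<in> {a + b | a b. a \<in> A \<and> b \<in> B}"
    then obtain v w where vw: "v \<in> I" "homogeneous d v" "kronecker \<phi> v \<noteq> 0"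
      "w \<in> J" "homogeneous e w" "kronecker \<phi> w \<noteq> 0"
      "k = degree (kronecker \<phi> v) + degree (kronecker \<phi> w)"
      unfolding A_def B_def kronecker_degrees_def by blast
    have "v * w \<in> ideal_product I J"
      unfolding ideal_product_def using vw by (auto intro: ideal.span_base)
    moreover have "kronecker \<phi> (v * w) \<noteq> 0" "degree (kronecker \<phi> (v * w)) = k"
      using vw by (simp_all add: kronecker_mult[OF add] degree_mult_eq)
    ultimately show "k \<in> C"
      unfolding C_def kronecker_degrees_def using homogeneous_mult vw by blast
  qed
  then have "card {a + b | a b. a \<in> A \<and> b \<in> B} \<le> card C"
    by (rule card_mono[OF C(1)])
  moreover have "min_gens I \<le> card A" "min_gens J \<le> card B"
    using P Q by (auto intro: min_gens_le)
  ultimately have main: "min_gens I + min_gens J \<le> min_gens (ideal_product I J) + 1"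
    using card_sumset_ge[OF P(4,5) Q(4,5)] C(2) by linarith
  moreover have "2 \<le> min_gens I" if "\<not> principal_ideal I"
    using min_gens_ge_2[OF P(1,3) that] .
  moreover have "2 \<le> min_gens J" if "\<not> principal_ideal J"
    using min_gens_ge_2[OF Q(1,3) that] .
  ultimately show ?thesis
    by auto
qed

end
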